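(* If the group $G$ has no center (that is, its center is trivial) and it satisfies the descending chain condition for normal subgroups, then there exists an element $h\in G$ such that the twisted conjugacy class $[e]_h$ is not a subgroup of $G$.
   Context: For $h\in G$, $[e]_h=\{z^{-1}h^{-1}zh\mid z\in G\}$ is the twisted conjugacy class of the unit element $e$ of $G$ with respect to the inner automorphism $x\mapsto h^{-1}xh$.
   Formalization: The group G is additionally assumed to be nontrivial, since for the trivial group the center is trivial and the chain condition holds, but the only class [e]_e = {e} is a subgroup. *)

theory Defs
  imports "HOL-Algebra.Coset"
begin

definition group_center :: "('a, 'b) monoid_scheme \<Rightarrow> 'a set" where
  "group_center G = {x \<in> carrier G. \<forall>y \<in> carrier G. x \<otimes>\<^bsub>G\<^esub> y = y \<otimes>\<^bsub>G\<^esub> x}"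

definition dcc_normal :: "('a, 'b) monoid_scheme \<Rightarrow> bool" where
  "dcc_normal G \<longleftrightarrow>
     (\<forall>N :: nat \<Rightarrow> 'a set.
        (\<forall>i. N i \<lhd> G) \<and> (\<forall>i. N (Suc i) \<subseteq> N i) \<longrightarrow>
        (\<exists>m. \<forall>i \<ge> m. N i = N m))"

definition twisted_conj_class ::
    "('a, 'b) monoid_scheme \<Rightarrow> ('a \<Rightarrow> 'a) \<Rightarrow> 'a \<Rightarrow> 'a set" where
  "twisted_conj_class G \<phi> x = {inv\<^bsub>G\<^esub> z \<otimes>\<^bsub>G\<^esub> x \<otimes>\<^bsub>G\<^esub> \<phi> z | z. z \<in> carrier G}"

definition inner_aut :: "('a, 'b) monoid_scheme \<Rightarrow> 'a \<Rightarrow> 'a \<Rightarrow> 'a" where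
  "inner_aut G h x = inv\<^bsub>G\<^esub> h \<otimes>\<^bsub>G\<^esub> x \<otimes>\<^bsub>G\<^esub> h"

definition unit_twisted_class :: "('a, 'b) monoid_scheme \<Rightarrow> 'a \<Rightarrow> 'a set" where
  "unit_twisted_class G h =
     {inv\<^bsub>G\<^esub> z \<otimes>\<^bsub>G\<^esub> inv\<^bsub>G\<^esub> h \<otimes>\<^bsub>G\<^esub> z \<otimes>\<^bsub>G\<^esub> h | z. z \<in> carrier G}"

lemma (in group) unit_twisted_class_eq:
  assumes "h \<in> carrier G"
  shows "unit_twisted_class G h = twisted_conj_class G (inner_aut G h) \<one>"
proof -
  have "inv z \<otimes> inv h \<otimes> z \<otimes> h = inv z \<otimes> \<one> \<otimes> inner_aut G h z" if "z \<in> carrier G" for z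
    using assms that by (simp add: inner_aut_def m_assoc)
  then show ?thesis
    by (simp add: unit_twisted_class_def twisted_conj_class_def Setcompr_eq_image cong: image_cong_simp)
qed

end

theory Submission
  imports Defs
begin

text \<open>
  The class \<open>[e]\<^sub>h\<close> is the set of all commutators \<open>z\<inverse> h\<inverse> z h\<close> with \<open>h\<close> fixed. Suppose that every
  such class is a subgroup. The commutator identity \<open>[zg, h] = g\<inverse> [z, h] g [g, h]\<close> then makes it
  normal. It never contains \<open>h\<close> itself unless \<open>h = e\<close>, because \<open>h = z\<inverse> h\<inverse> z h\<close> says that a
  conjugate of \<open>h\<inverse>\<close> is trivial. And if the centre is trivial, it contains an element other than
  \<open>e\<close> whenever \<open>h \<noteq> e\<close>.

  So start with any \<open>h\<^sub>0 \<noteq> e\<close> and keep choosing \<open>h\<^sub>i\<^sub>+\<^sub>1 \<noteq> e\<close> in the class of \<open>h\<^sub>i\<close>. Normality gives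
  that the class of \<open>h\<^sub>i\<^sub>+\<^sub>1\<close> lies in the class of \<open>h\<^sub>i\<close>, and the inclusion is proper since \<open>h\<^sub>i\<^sub>+\<^sub>1\<close>
  belongs only to the latter. This strictly descending sequence of normal subgroups
  contradicts the chain condition.
\<close>

lemma (in group) unit_twisted_class_normal:
  assumes h: "h \<in> carrier G" and sub: "subgroup (unit_twisted_class G h) G"
  shows "unit_twisted_class G h \<lhd> G"
  unfolding normal_inv_iff
proof (intro conjI ballI sub)
  fix x k
  assume x: "x \<in> carrier G" and "k \<in> unit_twisted_class G h"
  then obtain z where z: "z \<in> carrier G" and k: "k = inv z \<otimes> inv h \<otimes> z \<otimes> h"
    by (auto simp: unit_twisted_class_def)
  \<comment> \<open>The commutator identity, read with \<open>g = x\<inverse>\<close>.\<close>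
  define g where "g = inv x"
  have g: "g \<in> carrier G" and x_eq: "x = inv g"
    using x by (simp_all add: g_def)
  let ?zg = "inv (z \<otimes> g) \<otimes> inv h \<otimes> (z \<otimes> g) \<otimes> h"
  let ?g = "inv g \<otimes> inv h \<otimes> g \<otimes> h"
  have cancel: "a \<otimes> (inv a \<otimes> b) = b" if "a \<in> carrier G" "b \<in> carrier G" for a b
    using that by (simp add: m_assoc [symmetric])
  have "x \<otimes> k \<otimes> inv x = ?zg \<otimes> inv ?g"
    unfolding x_eq k using h z g by (simp add: m_assoc inv_mult_group cancel)
  also have "\<dots> \<in> unit_twisted_class G h"
  proof (rule subgroup.m_closed [OF sub _ subgroup.m_inv_closed [OF sub]])
    show "?zg \<in> unit_twisted_class G h" "?g \<in> unit_twisted_class G h"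
      unfolding unit_twisted_class_def using z g by blast+
  qed
  finally show "x \<otimes> k \<otimes> inv x \<in> unit_twisted_class G h" .
qed

text \<open>
  Every element of the class is a conjugate of \<open>h\<inverse>\<close> multiplied by \<open>h\<close>, and \<open>N\<close> contains both factors.
\<close>

lemma (in group) unit_twisted_class_subset_normal:
  assumes N: "N \<lhd> G" and h: "h \<in> N"
  shows "unit_twisted_class G h \<subseteq> N"
proof -
  interpret N: normal N G by (fact N)
  have "inv z \<otimes> inv h \<otimes> z \<otimes> h \<in> N" if "z \<in> carrier G" for z
    using that h by (intro N.m_closed N.inv_op_closed1 N.m_inv_closed)
  then show ?thesis
    by (auto simp: unit_twisted_class_def)
qed

lemma (in group) mem_unit_twisted_class_self:
  assumes h: "h \<in> carrier G" and mem: "h \<in> unit_twisted_class G h"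
  shows "h = \<one>"
proof -
  obtain z where z: "z \<in> carrier G" and eq: "inv z \<otimes> inv h \<otimes> z \<otimes> h = h"
    using mem by (auto simp: unit_twisted_class_def)
  have "inv z \<otimes> inv h \<otimes> z = \<one>"
    using eq z h by (simp add: r_cancel_one)
  then have "inv h \<otimes> z = z"
    using z h inv_solve_left' [of \<one> z "inv h \<otimes> z"] by (simp add: m_assoc)
  then show ?thesis
    using z h by simp
qed

lemma (in group) unit_twisted_class_nontrivial:
  assumes h: "h \<in> carrier G" and noncentral: "h \<notin> group_center G"
  shows "\<exists>k \<in> unit_twisted_class G h. k \<noteq> \<one>"
proof (rule ccontr)
  assume "\<not> ?thesis"
  then have trivial: "inv z \<otimes> inv h \<otimes> z \<otimes> h = \<one>" if "z \<in> carrier G" for z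
    using that by (auto simp: unit_twisted_class_def)
  have "h \<otimes> z = z \<otimes> h" if z: "z \<in> carrier G" for z
  proof -
    have "inv (h \<otimes> z) \<otimes> (z \<otimes> h) = \<one>"
      using trivial [OF z] z h by (simp add: inv_mult_group m_assoc)
    then have "inv (h \<otimes> z) = inv (z \<otimes> h)"
      using z h inv_equality [of "inv (h \<otimes> z)" "z \<otimes> h"] by simp
    then show ?thesis
      using z h inv_inj by (simp add: inj_on_eq_iff)
  qed
  then show False
    using h noncentral by (simp add: group_center_def)
qed

theorem corollary2:
  fixes G (structure)
  assumes "group G"
    and "carrier G \<noteq> {\<one>}"
    and "group_center G = {\<one>}"
    and "dcc_normal G"
  shows "\<exists>h \<in> carrier G. \<not> subgroup (unit_twisted_class G h) G"
proof (rule ccontr)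
  interpret group G by (fact assms(1))
  let ?C = "unit_twisted_class G"
  assume "\<not> ?thesis"
  then have normal: "?C h \<lhd> G" if "h \<in> carrier G" for h
    using that unit_twisted_class_normal by blast
  have "\<exists>h. \<forall>i. (h i \<in> carrier G \<and> h i \<noteq> \<one>) \<and> h (Suc i) \<in> ?C (h i)"
  proof (rule dependent_nat_choice)
    show "\<exists>x. x \<in> carrier G \<and> x \<noteq> \<one>"
      using assms(2) by auto
  next
    fix x and n :: nat
    assume x: "x \<in> carrier G \<and> x \<noteq> \<one>"
    then obtain y where "y \<in> ?C x" "y \<noteq> \<one>"
      using unit_twisted_class_nontrivial assms(3) by blast
    moreover have "?C x \<subseteq> carrier G"
      using normal x by (simp add: normal_imp_subgroup subgroup.subset)
    ultimately show "\<exists>y. (y \<in> carrier G \<and> y \<noteq> \<one>) \<and> y \<in> ?C x"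
      by blast
  qed
  then obtain h where h: "\<And>i. h i \<in> carrier G" "\<And>i. h i \<noteq> \<one>"
    and step: "\<And>i. h (Suc i) \<in> ?C (h i)"
    by blast
  have "\<forall>i. ?C (h (Suc i)) \<subseteq> ?C (h i)"
    using unit_twisted_class_subset_normal [OF normal [OF h(1)] step] by simp
  moreover have "\<forall>i. ?C (h i) \<lhd> G"
    using normal [OF h(1)] by simp
  ultimately have "\<exists>m. \<forall>i \<ge> m. ?C (h i) = ?C (h m)"
    using assms(4) [unfolded dcc_normal_def, THEN spec, of "\<lambda>i. ?C (h i)"] by simp
  then obtain m where "\<forall>i \<ge> m. ?C (h i) = ?C (h m)" ..
  then have "?C (h (Suc m)) = ?C (h m)"
    using le_SucI [OF le_refl] by blast
  then have "h (Suc m) \<in> ?C (h (Suc m))"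
    using step by simp
  then show False
    using mem_unit_twisted_class_self h by blast
qed

end
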